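(* Let $m\geq 2$ and $n\geq 2m$ be integers. Then \[\delta(m,n)=\tfrac12\big(\delta(m-1,n)+(m-1)\,\delta(m-2,n-4)+m-2\big).\]
   Context: $\mathrm{Sym}(n)$ is regarded as the Coxeter group of type $\mathrm{A}_{n-1}$ with fundamental reflections the adjacent transpositions $(i,i+1)$, $1\le i\le n-1$, and corresponding length function $\ell$. $\mathcal{I}(\mathrm{Sym}(n))$ is the set of elements of $\mathrm{Sym}(n)$ of order exactly $2$ (empty for $n\le 1$). For $x\in\mathcal{I}(\mathrm{Sym}(n))$, $\Delta_1(x)=\{y\in\mathcal{I}(\mathrm{Sym}(n)) : \ell(xy)=\ell(x)+\ell(y)\}$. For positive integers $m,n$ with $n\ge 2m$, $\delta(m,n)$ denotes $|\Delta_1(x)|$, where $x\in\mathrm{Sym}(n)$ is any product of $m$ distinct mutually commuting fundamental reflections (this number does not depend on the choice of $x$; e.g. one may take $x=(1\,2)(3\,4)\cdots(2m-1\;2m)$). By convention $\delta(0,n)=|\mathcal{I}(\mathrm{Sym}(n))|$ and $\delta(m,0)=0$. *)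

theory Defs
  imports Complex_Main "HOL-Algebra.Sym_Groups" "HOL-Algebra.Multiplicative_Group"
begin

text \<open>
  The symmetric group on \<open>{1..n}\<close> is \<^const>\<open>sym_group\<close>, with composition of functions as
  product, regarded as the Coxeter group of type A with the adjacent transpositions
  as fundamental reflections.
\<close>

definition fundamental_reflections :: "nat \<Rightarrow> (nat \<Rightarrow> nat) set" where
  "fundamental_reflections n = {transpose i (i + 1) | i. 1 \<le> i \<and> i < n}"

definition word_product :: "nat \<Rightarrow> (nat \<Rightarrow> nat) list \<Rightarrow> (nat \<Rightarrow> nat)" where
  "word_product n rs = foldr (\<lambda>r w. r \<otimes>\<^bsub>sym_group n\<^esub> w) rs \<one>\<^bsub>sym_group n\<^esub>"

definition coxeter_length :: "nat \<Rightarrow> (nat \<Rightarrow> nat) \<Rightarrow> nat" where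
  "coxeter_length n w =
     (LEAST k. \<exists>rs. set rs \<subseteq> fundamental_reflections n \<and> length rs = k \<and> word_product n rs = w)"

definition involutions :: "nat \<Rightarrow> (nat \<Rightarrow> nat) set" where
  "involutions n = {x \<in> carrier (sym_group n). group.ord (sym_group n) x = 2}"

definition Delta1 :: "nat \<Rightarrow> (nat \<Rightarrow> nat) \<Rightarrow> (nat \<Rightarrow> nat) set" where
  "Delta1 n x = {y \<in> involutions n.
     coxeter_length n (x \<otimes>\<^bsub>sym_group n\<^esub> y) = coxeter_length n x + coxeter_length n y}"

definition commuting_reflection_products :: "nat \<Rightarrow> nat \<Rightarrow> (nat \<Rightarrow> nat) set" where
  "commuting_reflection_products m n = {word_product n rs | rs.
     length rs = m \<and> distinct rs \<and> set rs \<subseteq> fundamental_reflections n \<and>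
     (\<forall>r \<in> set rs. \<forall>s \<in> set rs. r \<otimes>\<^bsub>sym_group n\<^esub> s = s \<otimes>\<^bsub>sym_group n\<^esub> r)}"

text \<open>
  For positive \<open>m\<close> and \<open>n \<ge> 2 * m\<close>, \<open>delta m n\<close> is the common cardinality of the sets
  \<open>Delta1 n x\<close>, where \<open>x\<close> ranges over all products of \<open>m\<close> distinct mutually commuting
  fundamental reflections; \<^const>\<open>the_elem\<close> extracts the only value attained.
  Arguments with \<open>0 < n < 2 * m\<close> carry no meaning.
\<close>

definition delta :: "nat \<Rightarrow> nat \<Rightarrow> nat" where
  "delta m n =
     (if m = 0 then card (involutions n)
      else if n = 0 then 0
      else the_elem ((\<lambda>x. card (Delta1 n x)) ` commuting_reflection_products m n))"

end

theory Submission
  imports Defs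
begin

text \<open>
  Let \<open>x\<close> be a product of commuting fundamental reflections \<open>(i, i + 1)\<close>, \<open>i \<in> J\<close>. As the length
  is the number of inversions, \<open>\<ell>(xy) = \<ell>(x) + \<ell>(y)\<close> holds for an involution \<open>y\<close> iff
  \<open>y i < y (i + 1)\<close> for all \<open>i \<in> J\<close>. Admitting \<open>y = 1\<close>, let \<open>f m n\<close> be the number of such \<open>y\<close>; then
  \<open>\<delta>(m,n) = f m n - 1\<close> and the claim becomes \<open>2 f m n = f (m - 1) n + (m - 1) f (m - 2) (n - 4)\<close>.
  To prove it, drop one index \<open>a\<close> of \<open>J\<close> and put \<open>b = a + 1\<close>. Conjugation by \<open>(a, b)\<close>, or
  multiplication by it if \<open>y\<close> stabilizes \<open>{a, b}\<close>, exchanges the \<open>y\<close> with \<open>y a > y b\<close> and those with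
  \<open>y a < y b\<close>, except for the \<open>y\<close> that map another pair \<open>(c, c + 1)\<close> to \<open>(a, b)\<close>; such a \<open>y\<close> is
  determined by its restriction to the other \<open>n - 4\<close> points. The recurrence is proved for involutions
  of an arbitrary finite ordered set with disjoint pairs of neighbours, as deleting these
  four points destroys the interval \<open>{1..n}\<close> but not adjacency.
\<close>

section \<open>Involutions ascending at given pairs of neighbours\<close>

definition asc_involutions :: "'a::linorder set \<Rightarrow> ('a \<times> 'a) set \<Rightarrow> ('a \<Rightarrow> 'a) set" where
  "asc_involutions S P = {y. y permutes S \<and> y \<circ> y = id \<and> (\<forall>(a, b)\<in>P. y a < y b)}"

definition adjacent_pairs :: "'a::linorder set \<Rightarrow> ('a \<times> 'a) set \<Rightarrow> bool" where
  "adjacent_pairs S P \<longleftrightarrow> P \<subseteq> S \<times> S \<and>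
     (\<forall>(a, b)\<in>P. a < b \<and> (\<forall>c\<in>S. c \<le> a \<or> b \<le> c)) \<and>
     (\<forall>(a, b)\<in>P. \<forall>(c, d)\<in>P. (a, b) \<noteq> (c, d) \<longrightarrow> {a, b} \<inter> {c, d} = {})"

lemma finite_asc_involutions: "finite S \<Longrightarrow> finite (asc_involutions S P)"
  by (rule finite_subset [OF _ finite_permutations]) (auto simp: asc_involutions_def)

lemma asc_involutionsD:
  assumes "y \<in> asc_involutions S P"
  shows "y permutes S" "y \<circ> y = id" "y (y u) = u" "(y u = y v) = (u = v)"
    "y u \<in> S \<longleftrightarrow> u \<in> S" "(a, b) \<in> P \<Longrightarrow> y a < y b"
proof -
  show p: "y permutes S" and c: "y \<circ> y = id" and "(a, b) \<in> P \<Longrightarrow> y a < y b"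
    using assms by (auto simp: asc_involutions_def)
  show "y (y u) = u"
    using c by (metis comp_apply id_apply)
  show "(y u = y v) = (u = v)" "y u \<in> S \<longleftrightarrow> u \<in> S"
    using permutes_inj [OF p] permutes_in_image [OF p] by (auto dest: injD)
qed

lemma asc_involutionsI:
  assumes "y permutes S" "\<And>u. y (y u) = u" "\<And>a b. (a, b) \<in> P \<Longrightarrow> y a < y b"
  shows "y \<in> asc_involutions S P"
  using assms by (auto simp: asc_involutions_def fun_eq_iff)

lemma adjacent_pairsD:
  assumes "adjacent_pairs S P" "(a, b) \<in> P"
  shows "a \<in> S" "b \<in> S" "a < b" "c \<in> S \<Longrightarrow> c \<le> a \<or> b \<le> c"
    "(c, d) \<in> P \<Longrightarrow> (c, d) \<noteq> (a, b) \<Longrightarrow> c \<noteq> a \<and> c \<noteq> b \<and> d \<noteq> a \<and> d \<noteq> b"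
proof -
  show "a \<in> S" "b \<in> S" "a < b" "c \<in> S \<Longrightarrow> c \<le> a \<or> b \<le> c"
    using assms unfolding adjacent_pairs_def by blast+
  assume "(c, d) \<in> P" "(c, d) \<noteq> (a, b)"
  with assms have "{a, b} \<inter> {c, d} = {}" unfolding adjacent_pairs_def by blast
  then show "c \<noteq> a \<and> c \<noteq> b \<and> d \<noteq> a \<and> d \<noteq> b" by blast
qed

text \<open>Being neighbours is relative to the ground set: shrinking it only removes candidates for
  lying between two points. This is what allows four points to be deleted.\<close>

lemma adjacent_pairs_subset:
  assumes "adjacent_pairs S P" "Q \<subseteq> P" "T \<subseteq> S" "Q \<subseteq> T \<times> T"
  shows "adjacent_pairs T Q"
  unfolding adjacent_pairs_def
proof (intro conjI)
  show "\<forall>(a, b)\<in>Q. a < b \<and> (\<forall>c\<in>T. c \<le> a \<or> b \<le> c)"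
  proof clarify
    fix a b assume "(a, b) \<in> Q"
    with assms(2) have "(a, b) \<in> P" by blast
    note ab = adjacent_pairsD [OF assms(1) this]
    show "a < b \<and> (\<forall>c\<in>T. c \<le> a \<or> b \<le> c)"
      using ab(3,4) assms(3) by blast
  qed
  have "{a, b} \<inter> {c, d} = {}"
    if "(a, b) \<in> Q" "(c, d) \<in> Q" "(a, b) \<noteq> (c, d)" for a b c d
    using adjacent_pairsD(5) [OF assms(1), of a b c d] that assms(2) by blast
  then show "\<forall>(a, b)\<in>Q. \<forall>(c, d)\<in>Q. (a, b) \<noteq> (c, d) \<longrightarrow> {a, b} \<inter> {c, d} = {}"
    by blast
qed (rule assms(4))

section \<open>The recurrence obtained by dropping one pair\<close>

text \<open>No element of \<open>S\<close> separates \<open>a\<close> from \<open>b\<close>, so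
  exchanging these two leaves the relative order of every other two elements of \<open>S\<close>
  intact.\<close>

lemma transpose_adjacent_less:
  fixes a b u v :: "'a::linorder"
  assumes "a < b" "\<And>c. c \<in> S \<Longrightarrow> c \<le> a \<or> b \<le> c"
    and "u \<in> S" "v \<in> S" "u < v" "\<not> (u = a \<and> v = b)"
  shows "transpose a b u < transpose a b v"
  using assms(1) assms(2)[OF assms(3)] assms(2)[OF assms(4)] assms(5,6)
  by (auto simp: transpose_def)

text \<open>Such a \<open>y\<close> swaps \<open>a\<close> with \<open>c\<close> and
  \<open>b\<close> with \<open>d\<close>, so it is the product of \<open>t = (a c)(b d)\<close> and
  an involution of the remaining points; composing with \<open>t\<close> passes between the two. The
  constraint at \<open>(c, d)\<close> then reads \<open>a < b\<close> and holds automatically, while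
  the other pairs avoid the four points.\<close>

lemma asc_involutions_exchange_count:
  assumes fin: "finite S" and adj: "adjacent_pairs S (insert (a, b) P)"
    and notin: "(a, b) \<notin> P" and cd: "(c, d) \<in> P"
  shows "card {y \<in> asc_involutions S P. y c = a \<and> y d = b} =
    card (asc_involutions (S - {a, b, c, d}) (P - {(c, d)}))"
proof (rule bij_betw_same_card)
  define t where "t = transpose a c \<circ> transpose b d"
  note ab = adjacent_pairsD [OF adj insertI1]
  note cdD = adjacent_pairsD [OF adj insertI2 [OF cd]]
  have ne: "c \<noteq> a" "c \<noteq> b" "d \<noteq> a" "d \<noteq> b"
    using ab(5) [of c d] cd notin by blast+
  have t4: "t a = c" "t b = d" "t c = a" "t d = b"
    using ne ab(3) cdD(3) by (auto simp: t_def transpose_def)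
  have t0: "t u = u" if "u \<notin> {a, b, c, d}" for u
    using that by (auto simp: t_def transpose_def)
  have tt: "t (t u) = u" for u
    by (cases "u \<in> {a, b, c, d}") (auto simp: t4 t0)
  have tperm: "t permutes S"
    unfolding t_def using ab(1,2) cdD(1,2) by (intro permutes_compose permutes_swap_id)
  have other: "u \<notin> {a, b, c, d}" "v \<notin> {a, b, c, d}" if "(u, v) \<in> P - {(c, d)}" for u v
    using ab(5) [of u v] cdD(5) [of u v] that notin by blast+
  show "bij_betw (\<lambda>y. y \<circ> t) {y \<in> asc_involutions S P. y c = a \<and> y d = b}
    (asc_involutions (S - {a, b, c, d}) (P - {(c, d)}))"
  \<comment> \<open>As \<open>t\<close> is its own inverse, the same map serves in both
    directions.\<close>
  proof (rule bij_betw_byWitness [where f' = "\<lambda>y. y \<circ> t"])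
    show "(\<lambda>y. y \<circ> t) ` {y \<in> asc_involutions S P. y c = a \<and> y d = b}
      \<subseteq> asc_involutions (S - {a, b, c, d}) (P - {(c, d)})"
    proof (rule image_subsetI)
      fix y assume "y \<in> {y \<in> asc_involutions S P. y c = a \<and> y d = b}"
      then have y: "y \<in> asc_involutions S P" and "y c = a" "y d = b" by auto
      note yD = asc_involutionsD [OF y]
      have y4: "y a = c" "y b = d" "y c = a" "y d = b"
        using \<open>y c = a\<close> \<open>y d = b\<close> yD(3) by metis+
      \<comment> \<open>The four points are permuted among themselves, so \<open>y\<close> also
        preserves their complement, on which \<open>t\<close> is the identity.\<close>
      have y0: "y u \<notin> {a, b, c, d}" if "u \<notin> {a, b, c, d}" for u
      proof
        assume "y u \<in> {a, b, c, d}"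
        then have "y (y u) \<in> {a, b, c, d}"
          by (elim insertE emptyE) (simp_all add: y4)
        then show False using that by (simp add: yD(3))
      qed
      show "y \<circ> t \<in> asc_involutions (S - {a, b, c, d}) (P - {(c, d)})"
      proof (rule asc_involutionsI)
        have "y \<circ> t permutes S"
          by (rule permutes_compose [OF tperm yD(1)])
        then show "y \<circ> t permutes S - {a, b, c, d}"
          by (rule permutes_superset) (auto simp: y4 t4)
        show "(y \<circ> t) ((y \<circ> t) u) = u" for u
          by (cases "u \<in> {a, b, c, d}") (auto simp: y4 t4 t0 [OF y0] t0 yD(3))
        show "(y \<circ> t) u < (y \<circ> t) v" if "(u, v) \<in> P - {(c, d)}" for u v
          using yD(6) [of u v] that by (simp add: t0 [OF other(1) [OF that]] t0 [OF other(2) [OF that]])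
      qed
    qed
    show "(\<lambda>y. y \<circ> t) ` asc_involutions (S - {a, b, c, d}) (P - {(c, d)})
      \<subseteq> {y \<in> asc_involutions S P. y c = a \<and> y d = b}"
    proof (rule image_subsetI)
      fix y assume y: "y \<in> asc_involutions (S - {a, b, c, d}) (P - {(c, d)})"
      note yD = asc_involutionsD [OF y]
      have y4: "y a = a" "y b = b" "y c = c" "y d = d"
        using permutes_not_in [OF yD(1)] by auto
      have y0: "y u \<notin> {a, b, c, d}" if "u \<notin> {a, b, c, d}" for u
      proof
        assume "y u \<in> {a, b, c, d}"
        then have "y (y u) \<in> {a, b, c, d}"
          by (elim insertE emptyE) (simp_all add: y4)
        then show False using that by (simp add: yD(3))
      qed
      have "y \<circ> t \<in> asc_involutions S P"
      proof (rule asc_involutionsI)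
        have "y permutes S"
          by (rule permutes_subset [OF yD(1)]) auto
        then show "y \<circ> t permutes S"
          by (rule permutes_compose [OF tperm])
        show "(y \<circ> t) ((y \<circ> t) u) = u" for u
          by (cases "u \<in> {a, b, c, d}") (auto simp: y4 t4 t0 [OF y0] t0 yD(3))
        show "(y \<circ> t) u < (y \<circ> t) v" if "(u, v) \<in> P" for u v
        proof (cases "(u, v) = (c, d)")
          case True
          then show ?thesis using ab(3) by (simp add: t4 y4)
        next
          case False
          then have uv: "(u, v) \<in> P - {(c, d)}" using that by auto
          then show ?thesis
            using yD(6) [of u v] uv by (simp add: t0 [OF other(1) [OF uv]] t0 [OF other(2) [OF uv]])
        qed
      qed
      then show "y \<circ> t \<in> {y \<in> asc_involutions S P. y c = a \<and> y d = b}"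
        by (simp add: y4 t4)
    qed
  qed (use tt in \<open>auto simp: fun_eq_iff\<close>)
qed


text \<open>\<open>A\<close> and \<open>D\<close> split the involutions ascending on
  \<open>P\<close>, and \<open>U\<close> collects those that carry some pair of \<open>P\<close> to
  \<open>(a, b)\<close>; they lie in \<open>A\<close>. A bijection of \<open>D\<close> onto
  \<open>A - U\<close> gives \<open>|A| = |D| + |U|\<close>, hence
  \<open>2 |A| = (|A| + |D|) + |U|\<close>.\<close>

lemma asc_involutions_recurrence:
  assumes fin: "finite S" and adj: "adjacent_pairs S (insert (a, b) P)" and notin: "(a, b) \<notin> P"
  shows "2 * card (asc_involutions S (insert (a, b) P)) = card (asc_involutions S P) +
    (\<Sum>(c, d)\<in>P. card (asc_involutions (S - {a, b, c, d}) (P - {(c, d)})))"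
proof -
  define s where "s = transpose a b"
  define A where "A = asc_involutions S (insert (a, b) P)"
  define D where "D = {y \<in> asc_involutions S P. y b < y a}"
  define E where "E = (\<lambda>p. {y \<in> asc_involutions S P. y (fst p) = a \<and> y (snd p) = b})"
  define U where "U = (\<Union>p\<in>P. E p)"
  note ab = adjacent_pairsD [OF adj insertI1]
  have Pne: "u \<noteq> a" "u \<noteq> b" "v \<noteq> a" "v \<noteq> b" if "(u, v) \<in> P" for u v
    using ab(5) [of u v] that notin by blast+
  have Pless: "u < v" if "(u, v) \<in> P" for u v
    using adjacent_pairsD(3) [OF adj insertI2 [OF that]] .
  have PS: "u \<in> S" "v \<in> S" if "(u, v) \<in> P" for u v
    using adjacent_pairsD(1,2) [OF adj insertI2 [OF that]] .
  have s2: "s a = b" "s b = a" and s0: "u \<noteq> a \<Longrightarrow> u \<noteq> b \<Longrightarrow> s u = u" and ss: "s (s u) = u" for u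
    by (auto simp: s_def)
  have sD: "s u = a \<longleftrightarrow> u = b" "s u = b \<longleftrightarrow> u = a" for u
    using s2 ss by metis+
  have sperm: "s permutes S"
    unfolding s_def by (rule permutes_swap_id [OF ab(1,2)])
  have sless: "s u < s v" if "u \<in> S" "v \<in> S" "u < v" "\<not> (u = a \<and> v = b)" for u v
    unfolding s_def by (rule transpose_adjacent_less [OF ab(3,4) that])
  have A_iff: "y \<in> A \<longleftrightarrow> y \<in> asc_involutions S P \<and> y a < y b" for y
    by (auto simp: A_def asc_involutions_def)
  have finI: "finite (asc_involutions S P)"
    by (rule finite_asc_involutions [OF fin])
  have "P \<subseteq> S \<times> S" using PS by auto
  then have finP: "finite P"
    by (rule finite_subset) (simp add: fin)
  \<comment> \<open>\<open>s\<close> fixes the points of pairs in \<open>P\<close>, so the conjugate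
    takes the values \<open>s (y u)\<close> there; \<open>s\<close> reverses
    \<open>y u < y v\<close> only when these values are exactly \<open>a\<close> and
    \<open>b\<close>.\<close>
  have conj: "s \<circ> y \<circ> s \<in> asc_involutions S P"
    if y: "y \<in> asc_involutions S P" and nU: "\<And>u v. (u, v) \<in> P \<Longrightarrow> \<not> (y u = a \<and> y v = b)" for y
  proof (rule asc_involutionsI)
    note yD = asc_involutionsD [OF y]
    show "s \<circ> y \<circ> s permutes S"
      by (intro permutes_compose sperm yD(1))
    show "(s \<circ> y \<circ> s) ((s \<circ> y \<circ> s) u) = u" for u
      by (simp add: ss yD(3))
    show "(s \<circ> y \<circ> s) u < (s \<circ> y \<circ> s) v" if "(u, v) \<in> P" for u v
      using sless [of "y u" "y v"] nU [OF that] yD(6) [OF that] PS [OF that] Pne [OF that]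
      by (simp add: s0 yD(5))
  qed
  \<comment> \<open>If \<open>y\<close> stabilizes \<open>{a, b}\<close>, conjugation by
    \<open>s\<close> returns \<open>y\<close> itself; multiplication by \<open>s\<close> swaps the
    values at \<open>a\<close> and \<open>b\<close> and leaves those on \<open>P\<close>
    alone.\<close>
  have mult: "y \<circ> s \<in> asc_involutions S P"
    if y: "y \<in> asc_involutions S P" and yab: "y a = a \<and> y b = b \<or> y a = b \<and> y b = a" for y
  proof (rule asc_involutionsI)
    note yD = asc_involutionsD [OF y]
    show "y \<circ> s permutes S"
      by (intro permutes_compose sperm yD(1))
    have y0: "y u \<noteq> a \<and> y u \<noteq> b" if "u \<noteq> a" "u \<noteq> b" for u
      using yab yD(4) that by metis
    show "(y \<circ> s) ((y \<circ> s) u) = u" for u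
    proof (cases "u = a \<or> u = b")
      case True
      then show ?thesis using yab by (elim disjE conjE) (simp_all add: s2)
    next
      case False
      then show ?thesis using y0 [of u] by (simp add: s0 yD(3))
    qed
    show "(y \<circ> s) u < (y \<circ> s) v" if "(u, v) \<in> P" for u v
      using yD(6) [OF that] Pne [OF that] by (simp add: s0)
  qed
  have UA: "U \<subseteq> A"
  proof
    fix y assume "y \<in> U"
    then obtain c d where cd: "(c, d) \<in> P" and y: "y \<in> asc_involutions S P" and "y c = a" "y d = b"
      by (auto simp: U_def E_def)
    then have "y a = c" "y b = d"
      using asc_involutionsD(3) [OF y] by blast+
    then show "y \<in> A"
      using y Pless [OF cd] by (simp add: A_iff)
  qed
  have "asc_involutions S P = A \<union> D"
  proof -
    have "y a \<noteq> y b" if "y \<in> asc_involutions S P" for y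
      using asc_involutionsD(4) [OF that] ab(3) by simp
    then have "y a < y b \<or> y b < y a" if "y \<in> asc_involutions S P" for y
      using that by (meson neq_iff)
    then show ?thesis unfolding D_def set_eq_iff Un_iff A_iff mem_Collect_eq by blast
  qed
  moreover have "A \<inter> D = {}"
    by (auto simp: A_iff D_def)
  ultimately have split: "card (asc_involutions S P) = card A + card D"
    using finI by (simp add: card_Un_disjoint)
  have "card U = (\<Sum>p\<in>P. card (E p))"
    unfolding U_def
  proof (rule card_UN_disjoint [OF finP])
    show "\<forall>p\<in>P. finite (E p)"
      using finI by (auto simp: E_def)
    \<comment> \<open>An involution carries at most one pair to \<open>(a, b)\<close>, as that pair
      is recovered by applying it to \<open>a\<close> and \<open>b\<close>.\<close>
    have "p = (y a, y b)" if "y \<in> E p" for p y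
      using that asc_involutionsD(3) [of y S P] by (auto simp: E_def)
    then show "\<forall>p\<in>P. \<forall>q\<in>P. p \<noteq> q \<longrightarrow> E p \<inter> E q = {}"
      by blast
  qed
  also have "\<dots> = (\<Sum>(c, d)\<in>P. card (asc_involutions (S - {a, b, c, d}) (P - {(c, d)})))"
    using asc_involutions_exchange_count [OF fin adj notin]
    by (intro sum.cong) (auto simp: E_def)
  finally have cardU: "card U = \<dots>" .
  \<comment> \<open>The stabilizing case is recognised by \<open>y a = b\<close> on
    \<open>D\<close>, where the two points cannot both be fixed, and by both being fixed on
    \<open>A\<close>, where they cannot be swapped. Hence the two maps use different tests.\<close>
  have "bij_betw (\<lambda>y. if y a = b then y \<circ> s else s \<circ> y \<circ> s) D (A - U)"
  proof (rule bij_betw_byWitness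
      [where f' = "\<lambda>y. if y a = a \<and> y b = b then y \<circ> s else s \<circ> y \<circ> s"])
    let ?f = "\<lambda>y. if y a = b then y \<circ> s else s \<circ> y \<circ> s"
    let ?g = "\<lambda>y. if y a = a \<and> y b = b then y \<circ> s else s \<circ> y \<circ> s"
    have cancel: "y \<circ> s \<circ> s = y" "s \<circ> (s \<circ> y \<circ> s) \<circ> s = y" for y
      by (auto simp: fun_eq_iff ss)
    show "\<forall>y\<in>D. ?g (?f y) = y"
    proof
      fix y assume "y \<in> D"
      then have y: "y \<in> asc_involutions S P" and d: "y b < y a"
        by (auto simp: D_def)
      note yD = asc_involutionsD [OF y]
      show "?g (?f y) = y"
      proof (cases "y a = b")
        case True
        then have "y b = a" using yD(3) by metis
        then show ?thesis using True by (simp add: s2 cancel)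
      next
        case False
        have "\<not> ((s \<circ> y \<circ> s) a = a \<and> (s \<circ> y \<circ> s) b = b)"
          using d ab(3) by (auto simp: s2 sD)
        then show ?thesis using False by (simp only: if_False cancel)
      qed
    qed
    show "\<forall>y\<in>A - U. ?f (?g y) = y"
    proof
      fix y assume "y \<in> A - U"
      then have y: "y \<in> asc_involutions S P" and d: "y a < y b"
        by (auto simp: A_iff)
      note yD = asc_involutionsD [OF y]
      show "?f (?g y) = y"
      proof (cases "y a = a \<and> y b = b")
        case True
        then show ?thesis by (simp add: s2 cancel)
      next
        case False
        have "y b \<noteq> a"
          using d ab(3) yD(3) by (metis less_asym)
        then have "(s \<circ> y \<circ> s) a \<noteq> b"
          by (simp add: s2 sD)
        then show ?thesis using False by (simp only: if_False cancel)
      qed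
    qed
    show "?f ` D \<subseteq> A - U"
    proof (rule image_subsetI)
      fix y assume "y \<in> D"
      then have y: "y \<in> asc_involutions S P" and d: "y b < y a"
        by (auto simp: D_def)
      note yD = asc_involutionsD [OF y]
      show "?f y \<in> A - U"
      proof (cases "y a = b")
        case True
        then have yb: "y b = a" using yD(3) by metis
        \<comment> \<open>\<open>y \<circ> s\<close> fixes \<open>a\<close>, so by injectivity no
          point of a pair in \<open>P\<close> is sent to \<open>a\<close>.\<close>
        have "y \<circ> s \<notin> U"
        proof
          assume "y \<circ> s \<in> U"
          then obtain u v where uv: "(u, v) \<in> P" and "y (s u) = a"
            by (auto simp: U_def E_def)
          then have "y u = y b" using Pne [OF uv] yb by (simp add: s0)
          then show False using yD(4) Pne [OF uv] by blast
        qed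
        then show ?thesis
          using True yb mult [OF y] ab(3) by (simp add: A_iff s2)
      next
        case False
        then have yb: "y b \<noteq> a" using yD(3) by metis
        \<comment> \<open>Otherwise \<open>y a = u < v = y b\<close>, against membership in
          \<open>D\<close>.\<close>
        have nU: "\<not> (y u = a \<and> y v = b)" if "(u, v) \<in> P" for u v
          using Pless [OF that] yD(3) d by (metis less_asym)
        have "s (y b) < s (y a)"
          using d yb by (intro sless) (simp_all add: yD(5) ab(1,2))
        \<comment> \<open>Undoing the conjugation, membership in \<open>U\<close> would force
          \<open>y u = b\<close> and \<open>y v = a\<close>, a descent at a pair of
          \<open>P\<close>.\<close>
        moreover have "s \<circ> y \<circ> s \<notin> U"
        proof
          assume "s \<circ> y \<circ> s \<in> U"
          then obtain u v where uv: "(u, v) \<in> P" and "s (y (s u)) = a" "s (y (s v)) = b"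
            by (auto simp: U_def E_def)
          then have "y u = b" "y v = a"
            using Pne [OF uv] by (simp_all add: s0 sD)
          then show False using yD(6) [OF uv] ab(3) by simp
        qed
        ultimately show ?thesis
          using False conj [OF y nU] by (simp add: A_iff s2)
      qed
    qed
    show "?g ` (A - U) \<subseteq> D"
    proof (rule image_subsetI)
      fix y assume "y \<in> A - U"
      then have y: "y \<in> asc_involutions S P" and d: "y a < y b" and "y \<notin> U"
        by (auto simp: A_iff)
      note yD = asc_involutionsD [OF y]
      show "?g y \<in> D"
      proof (cases "y a = a \<and> y b = b")
        case True
        then show ?thesis
          using mult [OF y] ab(3) by (simp add: D_def s2)
      next
        case False
        have nU: "\<not> (y u = a \<and> y v = b)" if "(u, v) \<in> P" for u v
          using that y \<open>y \<notin> U\<close> by (auto simp: U_def E_def)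
        \<comment> \<open>Here \<open>(y a, y b)\<close> differs from \<open>(a, b)\<close>, so
          \<open>s\<close> keeps the order; the conjugate takes these values at \<open>b\<close> and
          \<open>a\<close>, which is a descent.\<close>
        have "s (y a) < s (y b)"
          using d False by (intro sless) (simp_all add: yD(5) ab(1,2))
        then have "s \<circ> y \<circ> s \<in> D"
          using conj [OF y nU] by (simp add: D_def s2)
        then show ?thesis using False by (simp only: if_False)
      qed
    qed
  qed
  then have "card D = card (A - U)"
    by (rule bij_betw_same_card)
  moreover have "finite A"
    using finite_asc_involutions [OF fin] by (simp add: A_def)
  ultimately have "card A = card D + card U"
    using UA card_Diff_subset [of U A] card_mono [of A U] finite_subset by fastforce
  then show ?thesis
    unfolding A_def [symmetric] cardU [symmetric] split by simp
qed

section \<open>The count as a function of two cardinalities\<close>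

text \<open>Conjugation by \<open>f\<close> matches the permutations of the two sets and respects
  being self-inverse.\<close>

lemma card_asc_involutions_bij:
  assumes "bij_betw f S T"
  shows "card (asc_involutions S {}) = card (asc_involutions T {})"
proof -
  \<comment> \<open>The conjugate of \<open>y\<close> by \<open>f\<close> on \<open>T\<close>,
    extended by the identity, in the shape that \<open>bij_betw_permutations\<close> uses.\<close>
  define h where "h = (\<lambda>y x. if x \<in> T then f (y (inv_into S f x)) else x)"
  have fT: "f x \<in> T" if "x \<in> S" for x
    using assms that by (auto simp: bij_betw_def)
  have inj: "f x = f y \<longleftrightarrow> x = y" if "x \<in> S" "y \<in> S" for x y
    using assms that by (auto simp: bij_betw_def inj_on_def)
  have hf: "h y (f x) = f (y x)" if "x \<in> S" for x y
    using that fT assms by (simp add: h_def bij_betw_inv_into_left)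
  have "h y \<circ> h y = id \<longleftrightarrow> y \<circ> y = id" if "y permutes S" for y
  proof -
    have yS: "y x \<in> S" if "x \<in> S" for x
      using permutes_in_image [OF \<open>y permutes S\<close>] that by simp
    have hh: "h y (h y (f x)) = f (y (y x))" if "x \<in> S" for x
      by (simp only: hf [OF that] hf [OF yS [OF that]])
    have "h y \<circ> h y = id \<longleftrightarrow> (\<forall>x\<in>T. h y (h y x) = x)"
      by (auto simp: fun_eq_iff h_def)
    also have "\<dots> \<longleftrightarrow> (\<forall>x\<in>S. h y (h y (f x)) = f x)"
      using assms unfolding bij_betw_def by blast
    also have "\<dots> \<longleftrightarrow> (\<forall>x\<in>S. y (y x) = x)"
      by (intro ball_cong refl) (simp only: hh inj yS)
    also have "\<dots> \<longleftrightarrow> y \<circ> y = id"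
      using permutes_not_in [OF that] by (fastforce simp: fun_eq_iff)
    finally show ?thesis .
  qed
  then have "bij_betw h {y \<in> {y. y permutes S}. y \<circ> y = id} {y \<in> {y. y permutes T}. y \<circ> y = id}"
    using bij_betw_permutations [OF assms, folded h_def] by (intro bij_betw_Collect) auto
  then show ?thesis
    by (simp add: asc_involutions_def bij_betw_same_card)
qed

text \<open>The recurrence turned into a definition. Real values make the halving exact without a
  parity argument, and for \<open>m = 0\<close> the truncated \<open>m - 1\<close> is harmless
  because its term has the factor \<open>real m\<close>.\<close>

fun asc_count :: "nat \<Rightarrow> nat \<Rightarrow> real" where
  "asc_count 0 k = real (card (asc_involutions {1..k} {}))"
| "asc_count (Suc m) k = (asc_count m k + real m * asc_count (m - 1) (k - 4)) / 2"

text \<open>The recurrence sees only the numbers of points and pairs: by induction all its summands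
  agree, so the sum is \<open>card Q\<close> times one value. The induction is strong because the
  summands lose two pairs at once.\<close>

lemma card_asc_involutions:
  assumes "finite S" "adjacent_pairs S P"
  shows "real (card (asc_involutions S P)) = asc_count (card P) (card S)"
  using assms
proof (induction "card P" arbitrary: S P rule: less_induct)
  case less
  have finP: "finite P"
    using less.prems finite_subset [of P "S \<times> S"] by (auto simp: adjacent_pairs_def)
  show ?case
  proof (cases "P = {}")
    case True
    obtain f where "bij_betw f S {1..card S}"
      using less.prems(1) by (metis card_atLeastAtMost diff_Suc_1 finite_atLeastAtMost finite_same_card_bij)
    then show ?thesis
      using True card_asc_involutions_bij by simp
  next
    case False
    then obtain a b where ab: "(a, b) \<in> P" by auto
    define Q where "Q = P - {(a, b)}"
    have P: "P = insert (a, b) Q" and nQ: "(a, b) \<notin> Q"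
      using ab by (auto simp: Q_def)
    have finQ: "finite Q" and cP: "card P = Suc (card Q)"
      using finP nQ by (auto simp: P)
    have adj: "adjacent_pairs S (insert (a, b) Q)"
      using less.prems(2) by (simp add: P)
    have adjQ: "adjacent_pairs S Q"
      using adj by (rule adjacent_pairs_subset) (use adj in \<open>auto simp: adjacent_pairs_def\<close>)
    have "real (card (asc_involutions (S - {a, b, c, d}) (Q - {(c, d)}))) =
        asc_count (card Q - 1) (card S - 4)" if cd: "(c, d) \<in> Q" for c d
    proof -
      note ab' = adjacent_pairsD [OF adj insertI1]
      note cd' = adjacent_pairsD [OF adj insertI2 [OF cd]]
      have ne: "c \<noteq> a" "c \<noteq> b" "d \<noteq> a" "d \<noteq> b"
        using ab'(5) [of c d] cd nQ by blast+
      have card4: "card {a, b, c, d} = 4"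
        using ne ab'(3) cd'(3) by auto
      have sub: "{a, b, c, d} \<subseteq> S"
        using ab'(1,2) cd'(1,2) by simp
      have "u \<notin> {a, b, c, d} \<and> v \<notin> {a, b, c, d}" if "(u, v) \<in> Q - {(c, d)}" for u v
        using ab'(5) [of u v] cd'(5) [of u v] that nQ by blast
      moreover have "Q \<subseteq> S \<times> S"
        using adjQ by (simp add: adjacent_pairs_def)
      ultimately have "Q - {(c, d)} \<subseteq> (S - {a, b, c, d}) \<times> (S - {a, b, c, d})"
        by fast
      then have "adjacent_pairs (S - {a, b, c, d}) (Q - {(c, d)})"
        by (intro adjacent_pairs_subset [OF adjQ]) blast+
      moreover have "card (Q - {(c, d)}) = card Q - 1"
        using cd finQ by simp
      moreover have "card (S - {a, b, c, d}) = card S - 4"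
        using card_Diff_subset [OF _ sub] card4 by simp
      ultimately show ?thesis
        using less.hyps [of "Q - {(c, d)}" "S - {a, b, c, d}"] less.prems(1) cP by simp
    qed
    then have "(\<Sum>(c, d)\<in>Q. real (card (asc_involutions (S - {a, b, c, d}) (Q - {(c, d)})))) =
        (\<Sum>p\<in>Q. asc_count (card Q - 1) (card S - 4))"
      by (intro sum.cong) auto
    moreover have "real (2 * card (asc_involutions S P)) = real (card (asc_involutions S Q)) +
        (\<Sum>(c, d)\<in>Q. real (card (asc_involutions (S - {a, b, c, d}) (Q - {(c, d)}))))"
      unfolding P asc_involutions_recurrence [OF less.prems(1) adj nQ]
      by (simp add: case_prod_beta)
    moreover have "real (card (asc_involutions S Q)) = asc_count (card Q) (card S)"
      using less.hyps [of Q S] less.prems(1) adjQ cP by simp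
    ultimately show ?thesis
      by (simp add: cP)
  qed
qed

section \<open>Coxeter length and inversions\<close>

definition inversions :: "nat \<Rightarrow> (nat \<Rightarrow> nat) \<Rightarrow> (nat \<times> nat) set" where
  "inversions n v = {(a, b). a \<in> {1..n} \<and> b \<in> {1..n} \<and> a < b \<and> v b < v a}"

lemma finite_inversions: "finite (inversions n v)"
  by (rule finite_subset [of _ "{1..n} \<times> {1..n}"]) (auto simp: inversions_def)

lemma inversions_id [simp]: "inversions n id = {}" "inversions n (\<lambda>a. a) = {}"
  by (auto simp: inversions_def)

text \<open>\<open>s\<close> preserves the order of any two positions other than
  \<open>(i, Suc i)\<close>, so relabelling positions by \<open>s\<close> carries the inversions of
  \<open>v\<close> to inversions of \<open>v \<circ> s\<close>; the pair \<open>(i, Suc i)\<close>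
  is the only new one.\<close>

lemma card_inversions_transpose:
  assumes i: "1 \<le> i" "i < n" and less: "v i < v (Suc i)"
  shows "card (inversions n (v \<circ> transpose i (Suc i))) = Suc (card (inversions n v))"
proof -
  define s where "s = transpose i (Suc i)"
  have ss: "s (s u) = u" for u
    by (simp add: s_def)
  have sS: "s u \<in> {1..n}" if "u \<in> {1..n}" for u
    using that i by (auto simp: s_def transpose_def)
  have sless: "s a < s b" if "a < b" "(a, b) \<noteq> (i, Suc i)" for a b
    using that by (auto simp: s_def transpose_def)
  have "inversions n (v \<circ> s) = insert (i, Suc i) (map_prod s s ` inversions n v)"
  proof (intro equalityI subsetI)
    fix p assume p: "p \<in> inversions n (v \<circ> s)"
    obtain a b where ab: "p = (a, b)" by (cases p)
    show "p \<in> insert (i, Suc i) (map_prod s s ` inversions n v)"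
    proof (cases "p = (i, Suc i)")
      case False
      then have "(s a, s b) \<in> inversions n v"
        using p ab sS sless by (simp add: inversions_def)
      then have "map_prod s s (s a, s b) \<in> map_prod s s ` inversions n v"
        by (rule imageI)
      then show ?thesis by (simp add: ab ss)
    qed simp
  next
    fix p assume "p \<in> insert (i, Suc i) (map_prod s s ` inversions n v)"
    then consider "p = (i, Suc i)"
      | a b where "(a, b) \<in> inversions n v" "p = (s a, s b)"
      by auto
    then show "p \<in> inversions n (v \<circ> s)"
    proof cases
      case 1
      then show ?thesis using i less by (simp add: inversions_def s_def)
    next
      case 2
      then have "(a, b) \<noteq> (i, Suc i)"
        using less by (auto simp: inversions_def)
      then show ?thesis
        using 2 sS sless by (simp add: inversions_def ss)
    qed
  qed
  moreover have "(i, Suc i) \<notin> map_prod s s ` inversions n v"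
  proof
    assume "(i, Suc i) \<in> map_prod s s ` inversions n v"
    then obtain a b where ab: "a < b" "s a = i" "s b = Suc i"
      by (auto simp: inversions_def)
    then have "a = s i" "b = s (Suc i)" using ss by metis+
    then show False using ab(1) by (simp add: s_def)
  qed
  moreover have "inj_on (map_prod s s) (inversions n v)"
    by (rule inj_on_inverseI [where g = "map_prod s s"]) (auto simp: ss)
  ultimately show ?thesis
    by (simp add: finite_inversions card_image s_def)
qed

lemma card_inversions_transpose_descent:
  assumes "1 \<le> i" "i < n" "v (Suc i) < v i"
  shows "card (inversions n v) = Suc (card (inversions n (v \<circ> transpose i (Suc i))))"
  using card_inversions_transpose [of i n "v \<circ> transpose i (Suc i)"] assms
  by (simp add: comp_assoc)

section \<open>Length as the number of inversions\<close>

lemma word_product_simps: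
  "word_product n [] = id" "word_product n (r # rs) = r \<circ> word_product n rs"
  by (simp_all add: word_product_def sym_group_one sym_group_mult)

lemma fundamental_reflectionsE:
  assumes "r \<in> fundamental_reflections n"
  obtains i where "1 \<le> i" "i < n" "r = transpose i (Suc i)"
  using assms by (auto simp: fundamental_reflections_def)

lemma fundamental_reflection_permutes:
  assumes "r \<in> fundamental_reflections n"
  shows "r permutes {1..n}"
  using assms by (elim fundamental_reflectionsE) (auto intro!: permutes_swap_id)

lemma word_product_permutes:
  "set rs \<subseteq> fundamental_reflections n \<Longrightarrow> word_product n rs permutes {1..n}"
proof (induction rs)
  case (Cons r rs)
  then show ?case
    using fundamental_reflection_permutes [of r n]
    unfolding word_product_simps by (intro permutes_compose) simp_all
qed (simp add: word_product_simps permutes_id)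

lemma inv_reflection_comp:
  assumes "r \<in> fundamental_reflections n" "w permutes {1..n}"
  shows "inv' (r \<circ> w) = inv' w \<circ> r"
  using assms permutes_bij [OF assms(2)] fundamental_reflection_permutes [OF assms(1)]
  by (elim fundamental_reflectionsE) (simp add: o_inv_distrib)

text \<open>A word grows on the left, so its inverse grows on the right, where a reflection permutes
  positions and changes the inversion count by exactly one. This is why inversions of the inverse
  are counted.\<close>

lemma card_inversions_word_le:
  "set rs \<subseteq> fundamental_reflections n \<Longrightarrow>
    card (inversions n (inv' (word_product n rs))) \<le> length rs"
proof (induction rs)
  case Nil
  then show ?case by (simp add: word_product_simps)
next
  case (Cons r rs)
  let ?v = "inv' (word_product n rs)"
  have r: "r \<in> fundamental_reflections n" and rs: "set rs \<subseteq> fundamental_reflections n"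
    using Cons.prems by auto
  obtain i where i: "1 \<le> i" "i < n" "r = transpose i (Suc i)"
    using r by (rule fundamental_reflectionsE)
  have "?v permutes {1..n}"
    by (intro permutes_inv word_product_permutes rs)
  then have "?v i \<noteq> ?v (Suc i)"
    by (metis n_not_Suc_n permutes_inj injD)
  then have "card (inversions n (?v \<circ> r)) \<le> Suc (card (inversions n ?v))"
    using card_inversions_transpose [OF i(1,2), of ?v]
      card_inversions_transpose_descent [OF i(1,2), of ?v] i(3) by (cases "?v i < ?v (Suc i)") auto
  then show ?case
    using Cons.IH [OF rs] inv_reflection_comp [OF r word_product_permutes [OF rs]]
    by (simp only: word_product_simps list.size)
qed

text \<open>Bubble sort: each descent that is undone removes one inversion and contributes one
  letter, until no descent is left.\<close>

lemma word_of_inversion_length: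
  assumes "v permutes {1..n}"
  shows "\<exists>rs. set rs \<subseteq> fundamental_reflections n \<and> length rs = card (inversions n v) \<and>
    word_product n rs = inv' v"
  using assms
proof (induction "card (inversions n v)" arbitrary: v rule: less_induct)
  case less
  show ?case
  proof (cases "\<exists>i. 1 \<le> i \<and> i < n \<and> v (Suc i) < v i")
    case True
    then obtain i where i: "1 \<le> i" "i < n" and d: "v (Suc i) < v i" by auto
    let ?s = "transpose i (Suc i)"
    have s: "?s \<in> fundamental_reflections n"
      using i by (auto simp: fundamental_reflections_def)
    have vs: "v \<circ> ?s permutes {1..n}"
      by (intro permutes_compose fundamental_reflection_permutes s less.prems)
    have len: "card (inversions n v) = Suc (card (inversions n (v \<circ> ?s)))"
      by (rule card_inversions_transpose_descent [OF i d])
    then obtain rs where rs: "set rs \<subseteq> fundamental_reflections n"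
        "length rs = card (inversions n (v \<circ> ?s))" "word_product n rs = inv' (v \<circ> ?s)"
      using less.hyps [OF _ vs] by auto
    have "inv' (v \<circ> ?s) = ?s \<circ> inv' v"
      using permutes_bij [OF less.prems] by (simp add: o_inv_distrib)
    then have "word_product n (?s # rs) = inv' v"
      by (simp add: word_product_simps rs(3) fun_eq_iff)
    then show ?thesis
      using s rs(1,2) len by (intro exI [of _ "?s # rs"]) simp
  next
    case False
    have inj: "inj v"
      by (rule permutes_inj [OF less.prems])
    have asc: "v i < v (Suc i)" if "1 \<le> i" "i < n" for i
      using that False injD [OF inj, of i "Suc i"] by (metis n_not_Suc_n linorder_neqE_nat)
    \<comment> \<open>Without descents \<open>v\<close> increases along \<open>{1..n}\<close>, so
      \<open>i \<le> v i\<close>, which forces a permutation of \<open>{1..n}\<close> to be the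
      identity.\<close>
    have "i \<le> n \<Longrightarrow> i \<le> v i" if "1 \<le> i" for i
      using that
    proof (induction i rule: dec_induct)
      case base
      then show ?case using permutes_in_image [OF less.prems, of 1] by simp
    next
      case (step i)
      then show ?case using asc [of i] by simp
    qed
    then have "v = id"
      by (intro permutes_natset_ge [OF less.prems]) simp
    then show ?thesis
      by (intro exI [of _ "[]"]) (simp add: word_product_simps)
  qed
qed

lemma coxeter_length_eq_card_inversions:
  assumes "w permutes {1..n}"
  shows "coxeter_length n w = card (inversions n (inv' w))"
  unfolding coxeter_length_def
proof (rule Least_equality)
  show "\<exists>rs. set rs \<subseteq> fundamental_reflections n \<and> length rs = card (inversions n (inv' w)) \<and>
      word_product n rs = w"
    using word_of_inversion_length [OF permutes_inv [OF assms]] permutes_bij [OF assms]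
    by (simp add: inv_inv_eq)
next
  fix k assume "\<exists>rs. set rs \<subseteq> fundamental_reflections n \<and> length rs = k \<and> word_product n rs = w"
  then show "card (inversions n (inv' w)) \<le> k"
    using card_inversions_word_le by blast
qed

lemma coxeter_length_reflection_comp:
  assumes i: "1 \<le> i" "i < n" and w: "w permutes {1..n}"
  shows "inv' w i < inv' w (Suc i) \<Longrightarrow>
      coxeter_length n (transpose i (Suc i) \<circ> w) = Suc (coxeter_length n w)"
    and "\<not> inv' w i < inv' w (Suc i) \<Longrightarrow>
      coxeter_length n (transpose i (Suc i) \<circ> w) < coxeter_length n w"
proof -
  let ?s = "transpose i (Suc i)"
  have s: "?s \<in> fundamental_reflections n"
    using i by (auto simp: fundamental_reflections_def)
  have "?s \<circ> w permutes {1..n}"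
    by (intro permutes_compose fundamental_reflection_permutes s w)
  then have len: "coxeter_length n (?s \<circ> w) = card (inversions n (inv' w \<circ> ?s))"
    using inv_reflection_comp [OF s w] by (simp add: coxeter_length_eq_card_inversions)
  have "inv' w i \<noteq> inv' w (Suc i)"
    using permutes_inj [OF permutes_inv [OF w]] by (metis n_not_Suc_n injD)
  then show "inv' w i < inv' w (Suc i) \<Longrightarrow> coxeter_length n (?s \<circ> w) = Suc (coxeter_length n w)"
    and "\<not> inv' w i < inv' w (Suc i) \<Longrightarrow> coxeter_length n (?s \<circ> w) < coxeter_length n w"
    using card_inversions_transpose [OF i, of "inv' w"]
      card_inversions_transpose_descent [OF i, of "inv' w"] len
    by (auto simp: coxeter_length_eq_card_inversions [OF w])
qed

section \<open>Products of commuting fundamental reflections\<close>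

definition commuting_reflection_word :: "nat \<Rightarrow> (nat \<Rightarrow> nat) list \<Rightarrow> bool" where
  "commuting_reflection_word n rs \<longleftrightarrow> distinct rs \<and> set rs \<subseteq> fundamental_reflections n \<and>
     (\<forall>r \<in> set rs. \<forall>s \<in> set rs. r \<circ> s = s \<circ> r)"

lemma adjacent_transposition_eq_iff:
  "transpose i (Suc i) = transpose j (Suc j) \<longleftrightarrow> i = j"
proof
  assume eq: "transpose i (Suc i) = transpose j (Suc j)"
  show "i = j"
    using fun_cong [OF eq, of i] fun_cong [OF eq, of j]
    by (auto simp: transpose_def split: if_splits)
qed simp

lemma commuting_transpositions_disjoint:
  assumes "transpose i (Suc i) \<circ> transpose j (Suc j) = transpose j (Suc j) \<circ> transpose i (Suc i)"
    and "transpose i (Suc i) \<noteq> transpose j (Suc j)"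
  shows "{i, Suc i} \<inter> {j, Suc j} = {}"
proof -
  have "i \<noteq> j" using assms(2) by auto
  \<comment> \<open>If \<open>j = Suc i\<close>, the two products send \<open>i\<close> to
    \<open>Suc i\<close> and to \<open>Suc (Suc i)\<close>; the next case is symmetric.\<close>
  moreover have "j \<noteq> Suc i"
    using fun_cong [OF assms(1), of i] by (auto simp: transpose_def)
  moreover have "i \<noteq> Suc j"
    using fun_cong [OF assms(1), of j] by (auto simp: transpose_def)
  ultimately show ?thesis by auto
qed

lemma word_product_fixes:
  assumes "\<And>r. r \<in> set rs \<Longrightarrow> r u = u"
  shows "word_product n rs u = u"
  using assms by (induction rs) (auto simp: word_product_simps)

lemma commuting_reflection_word_ConsD:
  assumes "commuting_reflection_word n (r # rs)"
  shows "r \<in> fundamental_reflections n" "commuting_reflection_word n rs"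
    and "q \<in> set rs \<Longrightarrow> r \<circ> q = q \<circ> r" "q \<in> set rs \<Longrightarrow> r \<noteq> q"
  using assms unfolding commuting_reflection_word_def list.set distinct.simps by blast+

text \<open>Each letter raises the length by at most one, so the gain is full iff every step is an
  ascent. The letters being disjoint, the ascent condition at each of them refers to
  \<open>w\<close> alone. The inequality is carried along so that a loss at one letter cannot be
  made up by the others.\<close>

lemma coxeter_length_commuting_word:
  assumes "commuting_reflection_word n rs" and w: "w permutes {1..n}"
  shows "coxeter_length n (word_product n rs \<circ> w) \<le> length rs + coxeter_length n w \<and>
    (coxeter_length n (word_product n rs \<circ> w) = length rs + coxeter_length n w \<longleftrightarrow>
      (\<forall>i. transpose i (Suc i) \<in> set rs \<longrightarrow> inv' w i < inv' w (Suc i)))"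
  using assms(1)
proof (induction rs)
  case Nil
  then show ?case by (simp add: word_product_simps)
next
  case (Cons r rs)
  let ?x = "word_product n rs"
  note word = commuting_reflection_word_ConsD [OF Cons.prems]
  have rs: "set rs \<subseteq> fundamental_reflections n"
    using word(2) by (simp add: commuting_reflection_word_def)
  obtain i where i: "1 \<le> i" "i < n" and r: "r = transpose i (Suc i)"
    using word(1) by (rule fundamental_reflectionsE)
  have fix_i: "q i = i \<and> q (Suc i) = Suc i" if q: "q \<in> set rs" for q
  proof -
    obtain j where j: "q = transpose j (Suc j)"
      using subsetD [OF rs q] by (rule fundamental_reflectionsE)
    have "{i, Suc i} \<inter> {j, Suc j} = {}"
      using word(3,4) [OF q] unfolding r j by (rule commuting_transpositions_disjoint)
    then show ?thesis
      by (simp add: j)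
  qed
  have x: "?x permutes {1..n}"
    by (rule word_product_permutes [OF rs])
  have "?x i = i" "?x (Suc i) = Suc i"
    using fix_i by (simp_all add: word_product_fixes)
  then have "inv' ?x i = i" "inv' ?x (Suc i) = Suc i"
    by (simp_all add: permutes_inv_eq [OF x])
  moreover have "inv' (?x \<circ> w) = inv' w \<circ> inv' ?x"
    using permutes_bij [OF x] permutes_bij [OF w] by (rule o_inv_distrib)
  ultimately have inv: "inv' (?x \<circ> w) i = inv' w i" "inv' (?x \<circ> w) (Suc i) = inv' w (Suc i)"
    by simp_all
  have eq: "transpose j (Suc j) = r \<longleftrightarrow> j = i" for j
    by (simp add: r adjacent_transposition_eq_iff)
  note step = coxeter_length_reflection_comp [OF i permutes_compose [OF w x], folded r, unfolded inv]
  have len: "coxeter_length n (word_product n (r # rs) \<circ> w) = coxeter_length n (r \<circ> (?x \<circ> w))"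
    by (simp only: word_product_simps comp_assoc)
  define k where "k = coxeter_length n (?x \<circ> w)"
  define l where "l = coxeter_length n (r \<circ> (?x \<circ> w))"
  define A where "A = (\<lambda>j. inv' w j < inv' w (Suc j))"
  note IH = Cons.IH [OF word(2), folded k_def]
  have "l \<le> Suc (length rs) + coxeter_length n w \<and> (l = Suc (length rs) + coxeter_length n w \<longleftrightarrow>
      A i \<and> (\<forall>j. transpose j (Suc j) \<in> set rs \<longrightarrow> A j))"
  proof (cases "A i")
    case True
    then have "l = Suc k" using step(1) by (simp only: k_def l_def A_def)
    then show ?thesis using IH True by (auto simp: A_def)
  next
    case False
    \<comment> \<open>With the inductive bound on \<open>k\<close>, this keeps \<open>l\<close>
      strictly below the full sum.\<close>
    then have "l < k" using step(2) by (simp only: k_def l_def A_def not_False_eq_True)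
    then show ?thesis using IH False by (auto simp: A_def)
  qed
  moreover have "(\<forall>j. transpose j (Suc j) \<in> set (r # rs) \<longrightarrow> A j) \<longleftrightarrow>
      A i \<and> (\<forall>j. transpose j (Suc j) \<in> set rs \<longrightarrow> A j)"
    using eq by auto
  ultimately show ?case
    by (simp only: len l_def A_def list.size) simp
qed

lemma coxeter_length_id: "coxeter_length n id = 0"
  by (simp add: coxeter_length_eq_card_inversions permutes_id)

lemma coxeter_length_commuting_product:
  assumes "commuting_reflection_word n rs"
  shows "coxeter_length n (word_product n rs) = length rs"
  using coxeter_length_commuting_word [OF assms permutes_id] by (simp add: coxeter_length_id)

section \<open>From additivity of length to the numbers \<open>delta\<close>\<close>

lemma involutions_eq: "involutions n = asc_involutions {1..n} {} - {id}"
proof -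
  interpret group "sym_group n" by (rule sym_group_is_group)
  have "ord x = 2 \<longleftrightarrow> x \<circ> x = id \<and> x \<noteq> id" if x: "x \<in> carrier (sym_group n)" for x
  proof -
    have "x \<circ> x = id \<longleftrightarrow> ord x dvd 2"
      using pow_eq_id [OF x, of 2] x by (simp add: numeral_2_eq_2 sym_group_one sym_group_mult)
    moreover have "x = id \<longleftrightarrow> ord x = 1"
      using ord_eq_1 [OF x] by (simp add: sym_group_one)
    moreover have "ord x dvd 2 \<longleftrightarrow> ord x = 1 \<or> ord x = 2"
      using dvd_imp_le [of "ord x" 2] by (auto simp: le_Suc_eq numeral_2_eq_2)
    ultimately show ?thesis by auto
  qed
  then show ?thesis
    by (auto simp: involutions_def asc_involutions_def sym_group_carrier)
qed

text \<open>An involution is its own inverse, so the ascent criterion for \<open>inv' y\<close>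
  becomes one for \<open>y\<close>, and the general count applies. The subtracted one is the
  identity, which ascends everywhere but has order one.\<close>

lemma card_Delta1:
  assumes word: "commuting_reflection_word n rs"
  shows "real (card (Delta1 n (word_product n rs))) = asc_count (length rs) n - 1"
proof -
  define P where "P = {(i, Suc i) | i. transpose i (Suc i) \<in> set rs}"
  have dist: "distinct rs" and rs: "set rs \<subseteq> fundamental_reflections n"
    using word by (auto simp: commuting_reflection_word_def)
  have "bij_betw (\<lambda>(i, j). transpose i j) P (set rs)"
  proof (rule bij_betwI')
    fix p q assume "p \<in> P" "q \<in> P"
    then obtain i j where p: "p = (i, Suc i)" and q: "q = (j, Suc j)"
      by (auto simp: P_def)
    show "((case p of (i, j) \<Rightarrow> transpose i j) = (case q of (i, j) \<Rightarrow> transpose i j)) = (p = q)"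
      by (simp add: p q adjacent_transposition_eq_iff)
  next
    fix r assume "r \<in> set rs"
    moreover obtain i where "r = transpose i (Suc i)"
      using \<open>r \<in> set rs\<close> rs fundamental_reflectionsE [of r n] by auto
    ultimately show "\<exists>p\<in>P. r = (case p of (i, j) \<Rightarrow> transpose i j)"
      by (intro bexI [of _ "(i, Suc i)"]) (auto simp: P_def)
  qed (auto simp: P_def)
  then have cardP: "card P = length rs"
    by (simp add: bij_betw_same_card distinct_card [OF dist])
  \<comment> \<open>A permutation of \<open>{1..n}\<close> moves only points of that set, and the
    transposition moves both \<open>i\<close> and \<open>Suc i\<close>.\<close>
  have "1 \<le> i \<and> i < n" if i: "transpose i (Suc i) \<in> set rs" for i
  proof -
    have "transpose i (Suc i) permutes {1..n}"
      using i rs fundamental_reflection_permutes by blast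
    then have "i \<in> {1..n}" "Suc i \<in> {1..n}"
      using permutes_not_in by fastforce+
    then show ?thesis by simp
  qed
  moreover have "{i, Suc i} \<inter> {j, Suc j} = {}"
    if "transpose i (Suc i) \<in> set rs" "transpose j (Suc j) \<in> set rs" "i \<noteq> j" for i j
  proof (rule commuting_transpositions_disjoint)
    show "transpose i (Suc i) \<circ> transpose j (Suc j) = transpose j (Suc j) \<circ> transpose i (Suc i)"
      using that word by (auto simp: commuting_reflection_word_def)
    show "transpose i (Suc i) \<noteq> transpose j (Suc j)"
      using that(3) by (simp add: adjacent_transposition_eq_iff)
  qed
  ultimately have adj: "adjacent_pairs {1..n} P"
    unfolding adjacent_pairs_def P_def by fastforce
  have "Delta1 n (word_product n rs) = asc_involutions {1..n} P - {id}"
  proof -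
    have "coxeter_length n (word_product n rs \<circ> y) = coxeter_length n (word_product n rs) + coxeter_length n y
        \<longleftrightarrow> (\<forall>(i, j)\<in>P. y i < y j)" if "y \<in> asc_involutions {1..n} {}" for y
    proof -
      have "inv' y = y"
        using asc_involutionsD(2) [OF that] by (intro inv_unique_comp)
      then show ?thesis
        using coxeter_length_commuting_word [OF word asc_involutionsD(1) [OF that]]
        by (auto simp: coxeter_length_commuting_product [OF word] P_def)
    qed
    then show ?thesis
      unfolding Delta1_def involutions_eq sym_group_mult by (auto simp: asc_involutions_def)
  qed
  moreover have "id \<in> asc_involutions {1..n} P"
    by (auto simp: asc_involutions_def permutes_id P_def)
  ultimately show ?thesis
    using card_asc_involutions [OF _ adj] finite_asc_involutions [of "{1..n}" P]
      card_Suc_Diff1 [of "asc_involutions {1..n} P" id] cardP by simp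
qed

lemma commuting_reflection_products_eq:
  "commuting_reflection_products m n =
    {word_product n rs | rs. length rs = m \<and> commuting_reflection_word n rs}"
  by (simp add: commuting_reflection_products_def commuting_reflection_word_def sym_group_mult)

lemma commuting_reflection_products_nonempty:
  assumes "n \<ge> 2 * m"
  shows "commuting_reflection_products m n \<noteq> {}"
proof -
  \<comment> \<open>The witness is \<open>(1 2)(3 4)...(2m-1 2m)\<close>, which fits because
    \<open>2 * m \<le> n\<close>.\<close>
  define f :: "nat \<Rightarrow> nat \<Rightarrow> nat" where "f = (\<lambda>k. transpose (2 * k + 1) (Suc (2 * k + 1)))"
  have "inj f"
    by (simp add: inj_def f_def adjacent_transposition_eq_iff)
  moreover have "f k \<in> fundamental_reflections n" if "k < m" for k
    using that assms by (auto simp: f_def fundamental_reflections_def)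
  moreover have "f k \<circ> f l = f l \<circ> f k" for k l
  proof -
    have "2 * i \<noteq> Suc (2 * j)" "Suc (2 * j) \<noteq> 2 * i" for i j :: nat
      by presburger+
    then show ?thesis
      by (auto simp: f_def fun_eq_iff transpose_def)
  qed
  ultimately have "commuting_reflection_word n (map f [0..<m])"
    by (auto simp: commuting_reflection_word_def distinct_map inj_on_def inj_def)
  then show ?thesis
    unfolding commuting_reflection_products_eq by force
qed

text \<open>For \<open>m > 0\<close> every admissible product gives the same count, so the image
  under \<open>the_elem\<close> is a singleton, nonempty by the explicit witness. For
  \<open>m = 0\<close> the convention agrees with the same formula.\<close>

lemma delta_eq_asc_count:
  assumes "n \<ge> 2 * m"
  shows "real (delta m n) = asc_count m n - 1"
proof (cases "m = 0")
  case True
  have "id \<in> asc_involutions {1..n} {}"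
    by (simp add: asc_involutions_def permutes_id)
  then show ?thesis
    using True finite_asc_involutions [of "{1..n}" "{}"]
      card_Suc_Diff1 [of "asc_involutions {1..n} {}" id]
    by (simp add: delta_def involutions_eq)
next
  case False
  have D: "real (card (Delta1 n x)) = asc_count m n - 1" if "x \<in> commuting_reflection_products m n" for x
    using that card_Delta1 by (auto simp: commuting_reflection_products_eq)
  obtain x where x: "x \<in> commuting_reflection_products m n"
    using commuting_reflection_products_nonempty [OF assms] by auto
  have "(\<lambda>x. card (Delta1 n x)) ` commuting_reflection_products m n = {card (Delta1 n x)}"
    using D x by (metis (no_types, lifting) image_cong image_constant of_nat_eq_iff)
  \<comment> \<open>\<open>m > 0\<close> and \<open>2 * m \<le> n\<close> exclude the clause of
    \<open>delta\<close> for \<open>n = 0\<close>.\<close>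
  then show ?thesis
    using False assms D [OF x] by (simp add: delta_def)
qed

theorem theorem1p5:
  fixes m n :: nat
  assumes "m \<ge> 2" and "n \<ge> 2 * m"
  shows "real (delta m n) =
    1 / 2 * (real (delta (m - 1) n) + (real m - 1) * real (delta (m - 2) (n - 4)) + real m - 2)"
proof -
  \<comment> \<open>In this form the second equation of \<open>asc_count\<close> unfolds once, with
    factor \<open>real (Suc k) = real m - 1\<close>.\<close>
  obtain k where m: "m = Suc (Suc k)"
    using assms(1) by (metis add_2_eq_Suc le_Suc_ex)
  have "real (delta m n) = asc_count m n - 1" "real (delta (m - 1) n) = asc_count (m - 1) n - 1"
    "real (delta (m - 2) (n - 4)) = asc_count (m - 2) (n - 4) - 1"
    using assms by (auto intro!: delta_eq_asc_count)
  moreover have "asc_count m n =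
      (asc_count (m - 1) n + (real m - 1) * asc_count (m - 2) (n - 4)) / 2"
    unfolding m asc_count.simps(2) [of "Suc k"] by simp
  \<comment> \<open>The shifts by one add up to \<open>-1 - (m - 1) + m - 2 = -2\<close>, which
    halves to the shift on the left.\<close>
  ultimately show ?thesis
    by (simp only:) (simp add: field_simps)
qed

end
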